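(* As a $\mathbb{Q}$-vector space $R[t_0]$ has a basis consisting of the elements of the form $$t_0^{a_1}\odot t_0^{a_2}\odot\dots\odot t_0^{a_r}$$ where $r\ge1$ and $a_i\ge0$.
   Context: $[1,n]:=\{1,\dots,n\}$. For $n\ge0$ let $\mathcal{I}_n:=(\prod_{i=1}^nt_i)\cdot\mathbb{Q}[t_1,\dots,t_n]$, and $R:=\bigoplus_{n\ge0}\mathcal{I}_n$, so that as a $\mathbb{Q}$-vector space $R[t_0]=\bigoplus_{n\ge0}(\prod_{i=1}^nt_i)\,\mathbb{Q}[t_0,\dots,t_n]$. For $k\ge1$ there is the canonical map $R[t_0]\to\mathbb{Q}[t_0,\dots,t_k]$ sending $f(t_0,t_1,\dots,t_n)\in\mathcal{I}_n[t_0]$ to $\sum_{\alpha:[1,n]\hookrightarrow[1,k]}f(t_0,t_{\alpha(1)},\dots,t_{\alpha(n)})$ (sum over strictly increasing $\alpha$); an element of $R[t_0]$ is determined by its images for all $k$. The associative, non-commutative, non-unital product $\odot$ on $R[t_0]$ is defined geometrically: $\widetilde{\mathcal{M}}_{0,2}=\mathrm{B}\mathbb{G}_m\times\mathcal{W}$ is the stack of zollstocks (two-pointed nodal curves of genus $0$ which are chains of projective lines with the two marked points, distinct from the nodes, on the first and last component respectively), $A_*(\widetilde{\mathcal{M}}_{0,2})\cong R[t_0]$ is its Chow homology with $\mathbb{Q}$-coefficients, and $\odot$ is the push-forward along the proper morphism $\widetilde{\mathcal{M}}_{0,2}\times\widetilde{\mathcal{M}}_{0,2}\to\widetilde{\mathcal{M}}_{0,2}$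 which glues the second marked point of the first zollstock to the first marked point of the second. Explicitly, $\odot$ is the $\mathbb{Q}$-bilinear product such that for $f\in\mathcal{I}_n[t_0]$, $g\in\mathcal{I}_m[t_0]$ and every $k\ge1$ the image of $f\odot g$ in $\mathbb{Q}[t_0,\dots,t_k]$ is $$\sum_{j=1}^k\Big(\sum_{\alpha:[1,n]\hookrightarrow[1,j-1]}f(t_0,t_{\alpha(1)},\dots,t_{\alpha(n)})\Big)\,t_j\,\Big(\sum_{\beta:[1,m]\hookrightarrow[j+1,k]}g\big(\textstyle\sum_{i=0}^jt_i,t_{\beta(1)},\dots,t_{\beta(m)}\big)\Big),$$ with $\alpha,\beta$ running through strictly increasing maps. *)

theory Defs
  imports Complex_Main "HOL-Library.Poly_Mapping" "HOL-Library.FuncSet"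
begin

section \<open>Rational polynomials in the variables $t_0, t_1, t_2, \dots$\<close>

type_synonym mpoly = "(nat \<Rightarrow>\<^sub>0 nat) \<Rightarrow>\<^sub>0 rat"

definition Const :: "rat \<Rightarrow> mpoly" where
  "Const c = Poly_Mapping.single 0 c"

definition Var :: "nat \<Rightarrow> mpoly" where
  "Var i = Poly_Mapping.single (Poly_Mapping.single i 1) 1"

definition vars :: "mpoly \<Rightarrow> nat set" where
  "vars p = (\<Union>m\<in>Poly_Mapping.keys p. Poly_Mapping.keys m)"

definition subst :: "(nat \<Rightarrow> mpoly) \<Rightarrow> mpoly \<Rightarrow> mpoly" where
  "subst \<sigma> p = (\<Sum>m\<in>Poly_Mapping.keys p. Const (Poly_Mapping.lookup p m) *
     (\<Prod>i\<in>Poly_Mapping.keys m. \<sigma> i ^ Poly_Mapping.lookup m i))"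


section \<open>The vector space $R[t_0]$\<close>

text \<open>
  An element of the direct sum of the spaces $\mathcal{I}_n[t_0]$ is a finitely supported
  sequence of polynomials whose entry at \<open>n\<close> lies in \<open>I0 n\<close>, which is
  $\mathcal{I}_n[t_0] = (\prod_{i=1}^n t_i)\,\mathbb{Q}[t_0,\dots,t_n]$.
\<close>

definition I0 :: "nat \<Rightarrow> mpoly set" where
  "I0 n = {(\<Prod>i=1..n. Var i) * p | p. vars p \<subseteq> {0..n}}"

type_synonym mpoly_seq = "nat \<Rightarrow>\<^sub>0 mpoly"

definition Rt0 :: "mpoly_seq set" where
  "Rt0 = {F. \<forall>n. Poly_Mapping.lookup F n \<in> I0 n}"

definition qscale :: "rat \<Rightarrow> mpoly_seq \<Rightarrow> mpoly_seq" where
  "qscale c F = Poly_Mapping.map (\<lambda>p. Const c * p) F"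

lemma lookup_qscale:
  "Poly_Mapping.lookup (qscale c F) n = Const c * Poly_Mapping.lookup F n"
  by (simp add: qscale_def Poly_Mapping.map.rep_eq when_def)

text \<open>
  The scalar action is considered on all finitely supported sequences; \<open>Rt0\<close> is a
  linear subspace.
\<close>

interpretation Rt0: vector_space qscale
proof
  have add: "Const (a + b) = Const a + Const b" for a b
    by (simp add: Const_def single_add)
  have mult: "Const (a * b) = Const a * Const b" for a b
    by (simp add: Const_def mult_single)
  have one: "Const 1 = 1"
    by (simp add: Const_def)
  fix a b :: rat and F G :: mpoly_seq
  show "qscale a (F + G) = qscale a F + qscale a G"
    by (rule poly_mapping_eqI) (simp add: lookup_qscale lookup_add distrib_left)
  show "qscale (a + b) F = qscale a F + qscale b F"
    by (rule poly_mapping_eqI) (simp add: lookup_qscale lookup_add add distrib_right)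
  show "qscale a (qscale b F) = qscale (a * b) F"
    by (rule poly_mapping_eqI) (simp add: lookup_qscale mult mult.assoc)
  show "qscale 1 F = F"
    by (rule poly_mapping_eqI) (simp add: lookup_qscale one)
qed

definition t0_power :: "nat \<Rightarrow> mpoly_seq" where
  "t0_power a = Poly_Mapping.single 0 (Var 0 ^ a)"


section \<open>The canonical maps and the product\<close>

text \<open>
  Strictly increasing maps from $[1,n]$ to \<open>A\<close>; \<open>PiE\<close> (extensionality) makes
  functions that agree on $[1,n]$ equal, so that they are counted once.
\<close>

definition incr_maps :: "nat \<Rightarrow> nat set \<Rightarrow> (nat \<Rightarrow> nat) set" where
  "incr_maps n A = {\<alpha> \<in> {1..n} \<rightarrow>\<^sub>E A. strict_mono_on {1..n} \<alpha>}"

text \<open>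
  The additive extension to \<open>Rt0\<close> of
  $f \mapsto \sum_{\alpha : [1,n] \hookrightarrow A} f(s, t_{\alpha(1)}, \dots, t_{\alpha(n)})$
  for $f \in \mathcal{I}_n[t_0]$.
\<close>

definition incr_sum :: "mpoly \<Rightarrow> nat set \<Rightarrow> mpoly_seq \<Rightarrow> mpoly" where
  "incr_sum s A F = (\<Sum>n\<in>Poly_Mapping.keys F. \<Sum>\<alpha>\<in>incr_maps n A.
     subst (\<lambda>i. if i = 0 then s else Var (\<alpha> i)) (Poly_Mapping.lookup F n))"

definition canon :: "nat \<Rightarrow> mpoly_seq \<Rightarrow> mpoly" where
  "canon k F = incr_sum (Var 0) {1..k} F"

text \<open>
  Elements of \<open>Rt0\<close> are determined by their images under \<open>canon k\<close> for
  $k \ge 1$. Since \<open>incr_sum s A\<close> is linear, the formula below is the bilinear extension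
  of its restriction to homogeneous \<open>F\<close> and \<open>G\<close>.
\<close>

definition odot :: "mpoly_seq \<Rightarrow> mpoly_seq \<Rightarrow> mpoly_seq" (infixl "\<odot>" 70) where
  "F \<odot> G = (THE H. H \<in> Rt0 \<and> (\<forall>k\<ge>1. canon k H =
     (\<Sum>j=1..k. incr_sum (Var 0) {1..j-1} F * Var j *
        incr_sum (\<Sum>i=0..j. Var i) {j+1..k} G)))"

text \<open>
  The list \<open>[a\<^sub>1, \<dots>, a\<^sub>r]\<close> is sent to
  $t_0^{a_1} \odot \dots \odot t_0^{a_r}$, bracketed to the left (the product is associative).
  It is meant for nonempty lists only: \<open>\<odot>\<close> has no unit.
\<close>

definition odot_word :: "nat list \<Rightarrow> mpoly_seq" where
  "odot_word as = foldl (\<odot>) (t0_power (hd as)) (map t0_power (tl as))"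

end

theory Submission
  imports Defs "HOL-Library.Function_Algebras"
begin

text \<open>
  An element of $R[t_0]$ is handled through its family of images in $\mathbb{Q}[t_0, \dots, t_k]$,
  $k \ge 0$. On families, right multiplication by $t_0^b$ is
  $T_b(A)_k = \sum_{j \le k} A_{j-1} t_j p_j^b$ with $p_j = t_0 + \dots + t_j$, whereas
  $C_b(A)_k = \sum_{j \le k} A_{j-1} t_j^{b+1}$ turns one monomial quasi-symmetric family
  into the next. Expanding $p_j^b = (p_{j-1} + t_j)^b$ gives
  $T_b = \sum_{i \le b} \binom{b}{i} C_{b-i} \circ q^i$, where $q(A)_k = p_k A_k$ is a quasi-shuffle
  on monomial families. Hence $T_b$ is $C_b$ up to terms $C_{b'}$ with $b' < b$, and by induction
  every monomial family of degree less than $d$ is a combination of words of degree less than $d$.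
  There are as many such words as monomial families, and the latter are
  linearly independent, so the words are a basis in each degree range.
\<close>

section \<open>Substitution into monomials and polynomials\<close>

definition msubst :: "(nat \<Rightarrow> mpoly) \<Rightarrow> (nat \<Rightarrow>\<^sub>0 nat) \<Rightarrow> mpoly" where
  "msubst \<sigma> m = (\<Prod>i\<in>Poly_Mapping.keys m. \<sigma> i ^ Poly_Mapping.lookup m i)"

lemma msubst_superset:
  assumes "finite K" "Poly_Mapping.keys m \<subseteq> K"
  shows "msubst \<sigma> m = (\<Prod>i\<in>K. \<sigma> i ^ Poly_Mapping.lookup m i)"
  unfolding msubst_def
  by (rule prod.mono_neutral_left) (use assms in \<open>auto simp: in_keys_iff\<close>)

lemma msubst_add: "msubst \<sigma> (m + m') = msubst \<sigma> m * msubst \<sigma> m'"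
proof -
  let ?K = "Poly_Mapping.keys m \<union> Poly_Mapping.keys m'"
  have "Poly_Mapping.keys (m + m') \<subseteq> ?K"
    by (rule Poly_Mapping.keys_add)
  then show ?thesis
    by (simp add: msubst_superset[of ?K] lookup_add power_add prod.distrib)
qed

lemma msubst_single: "msubst \<sigma> (Poly_Mapping.single i e) = \<sigma> i ^ e"
  by (simp add: msubst_def)

lemma msubst_cong:
  assumes "\<And>i. i \<in> Poly_Mapping.keys m \<Longrightarrow> \<sigma> i = \<tau> i"
  shows "msubst \<sigma> m = msubst \<tau> m"
  unfolding msubst_def using assms by (intro prod.cong) auto

lemma Const_add: "Const (a + b) = Const a + Const b"
  by (simp add: Const_def single_add)

lemma Const_mult: "Const (a * b) = Const a * Const b"
  by (simp add: Const_def mult_single)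

lemma Const_0: "Const 0 = 0" and Const_1: "Const 1 = 1"
  by (simp_all add: Const_def)

lemma Const_of_nat: "Const (of_nat n) = of_nat n"
  by (induction n) (simp_all add: Const_0 Const_1 Const_add)

lemma lookup_Const_mult:
  "Poly_Mapping.lookup (Const c * p) m = c * Poly_Mapping.lookup p m"
  by (simp add: Const_def flip: mult_map_scale_conv_mult) (simp add: Poly_Mapping.map.rep_eq when_def)

lemma subst_superset:
  assumes "finite K" "Poly_Mapping.keys p \<subseteq> K"
  shows "subst \<sigma> p = (\<Sum>m\<in>K. Const (Poly_Mapping.lookup p m) * msubst \<sigma> m)"
  unfolding subst_def msubst_def
  by (rule sum.mono_neutral_left) (use assms in \<open>auto simp: in_keys_iff Const_0\<close>)

lemma subst_0: "subst \<sigma> 0 = 0"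
  by (simp add: subst_def)

lemma subst_add: "subst \<sigma> (p + q) = subst \<sigma> p + subst \<sigma> q"
proof -
  let ?K = "Poly_Mapping.keys p \<union> Poly_Mapping.keys q"
  have "Poly_Mapping.keys (p + q) \<subseteq> ?K"
    by (rule Poly_Mapping.keys_add)
  then show ?thesis
    by (simp add: subst_superset[of ?K] lookup_add Const_add distrib_right sum.distrib)
qed

lemma subst_Const_mult: "subst \<sigma> (Const c * p) = Const c * subst \<sigma> p"
proof -
  have "Poly_Mapping.keys (Const c * p) \<subseteq> Poly_Mapping.keys p"
    by (auto simp: in_keys_iff lookup_Const_mult)
  then show ?thesis
    by (simp add: subst_superset[of "Poly_Mapping.keys p"] lookup_Const_mult Const_mult
        sum_distrib_left mult.assoc)
qed

lemma subst_monomial: "subst \<sigma> (Poly_Mapping.single m 1) = msubst \<sigma> m"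
  by (simp add: subst_superset[of "{m}"] Const_1)

lemma Var_power: "Var i ^ e = Poly_Mapping.single (Poly_Mapping.single i e) 1"
proof (induction e)
  case (Suc e)
  then show ?case
    by (simp add: Var_def mult_single flip: single_add)
qed simp

section \<open>Linearity and recursion of sums over increasing maps\<close>

lemma incr_sum_superset:
  assumes "finite K" "Poly_Mapping.keys F \<subseteq> K"
  shows "incr_sum s A F = (\<Sum>n\<in>K. \<Sum>\<alpha>\<in>incr_maps n A.
     subst (\<lambda>i. if i = 0 then s else Var (\<alpha> i)) (Poly_Mapping.lookup F n))"
  unfolding incr_sum_def
  by (rule sum.mono_neutral_left) (use assms in \<open>auto simp: in_keys_iff subst_0\<close>)

lemma incr_sum_add: "incr_sum s A (F + G) = incr_sum s A F + incr_sum s A G"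
proof -
  let ?K = "Poly_Mapping.keys F \<union> Poly_Mapping.keys G"
  have "Poly_Mapping.keys (F + G) \<subseteq> ?K"
    by (rule Poly_Mapping.keys_add)
  then show ?thesis
    by (simp add: incr_sum_superset[of ?K] lookup_add subst_add sum.distrib)
qed

lemma incr_sum_qscale: "incr_sum s A (qscale c F) = Const c * incr_sum s A F"
proof -
  have "Poly_Mapping.keys (qscale c F) \<subseteq> Poly_Mapping.keys F"
    by (auto simp: in_keys_iff lookup_qscale)
  then show ?thesis
    by (simp add: incr_sum_superset[of "Poly_Mapping.keys F"] lookup_qscale subst_Const_mult
        sum_distrib_left)
qed

lemma incr_sum_monomial:
  "incr_sum s A (Poly_Mapping.single n (Poly_Mapping.single m 1)) =
    (\<Sum>\<alpha>\<in>incr_maps n A. msubst (\<lambda>i. if i = 0 then s else Var (\<alpha> i)) m)"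
  by (simp add: incr_sum_superset[of "{n}"] subst_monomial)

lemma incr_maps_0: "incr_maps 0 A = {\<lambda>_. undefined}"
  by (auto simp: incr_maps_def)

lemma incr_sum_t0_power: "incr_sum s A (t0_power b) = s ^ b"
  by (simp add: t0_power_def Var_power incr_sum_monomial incr_maps_0 msubst_single)

text \<open>A strictly increasing map on [1,n+1] amounts to its last value \<open>j\<close> together
  with a strictly increasing map from [1,n] to [1,j-1]. This is the recursion that
  \<open>fam_mono\<close> imitates.\<close>

lemma sum_incr_maps_Suc:
  fixes f :: "(nat \<Rightarrow> nat) \<Rightarrow> 'a :: comm_monoid_add"
  shows "(\<Sum>\<alpha>\<in>incr_maps (Suc n) {1..k}. f \<alpha>) =
    (\<Sum>j=1..k. \<Sum>\<alpha>\<in>incr_maps n {1..j - 1}. f (\<alpha>(Suc n := j)))"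
proof -
  have fin: "finite (incr_maps n {1..j - 1})" for j :: nat
    unfolding incr_maps_def
    by (rule finite_subset[of _ "{1..n} \<rightarrow>\<^sub>E {1..j - 1}"]) (auto intro!: finite_PiE)
  have "(\<Sum>j=1..k. \<Sum>\<alpha>\<in>incr_maps n {1..j - 1}. f (\<alpha>(Suc n := j))) =
      (\<Sum>(j, \<alpha>)\<in>(SIGMA j:{1..k}. incr_maps n {1..j - 1}). f (\<alpha>(Suc n := j)))"
    by (rule sum.Sigma) (use fin in auto)
  \<comment> \<open>The inverse of appending a value resets the place \<open>Suc n\<close> to
    \<open>undefined\<close>, as extensionality on [1,n] demands.\<close>
  also have "\<dots> = (\<Sum>\<alpha>\<in>incr_maps (Suc n) {1..k}. f \<alpha>)"
  proof (rule sum.reindex_bij_witness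
      [where j = "\<lambda>(j, \<alpha>). \<alpha>(Suc n := j)" and i = "\<lambda>\<alpha>. (\<alpha> (Suc n), \<alpha>(Suc n := undefined))"])
    fix a assume a: "a \<in> (SIGMA j:{1..k}. incr_maps n {1..j - 1})"
    obtain j \<alpha> where [simp]: "a = (j, \<alpha>)" by force
    from a have j: "j \<in> {1..k}" and \<alpha>: "\<alpha> \<in> {1..n} \<rightarrow>\<^sub>E {1..j - 1}"
      and mono: "strict_mono_on {1..n} \<alpha>"
      by (auto simp: incr_maps_def)
    have "\<alpha> (Suc n) = undefined"
      using \<alpha> by (auto simp: PiE_def extensional_def)
    then show "((case a of (j, \<alpha>) \<Rightarrow> \<alpha>(Suc n := j)) (Suc n),
        (case a of (j, \<alpha>) \<Rightarrow> \<alpha>(Suc n := j))(Suc n := undefined)) = a"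
      by (auto simp: fun_eq_iff)
    have lt: "\<alpha> i < j" "1 \<le> \<alpha> i" if "i \<in> {1..n}" for i
      using PiE_mem[OF \<alpha> that] by auto
    have "\<alpha>(Suc n := j) \<in> {1..Suc n} \<rightarrow>\<^sub>E {1..k}"
    proof (rule PiE_I)
      fix i assume "i \<in> {1..Suc n}"
      then show "(\<alpha>(Suc n := j)) i \<in> {1..k}"
        using j lt[of i] by (cases "i = Suc n") auto
    next
      fix i assume "i \<notin> {1..Suc n}"
      then show "(\<alpha>(Suc n := j)) i = undefined"
        using \<alpha> by (auto simp: PiE_def extensional_def)
    qed
    moreover have "strict_mono_on {1..Suc n} (\<alpha>(Suc n := j))"
    proof (rule strict_mono_onI)
      fix r s assume "r \<in> {1..Suc n}" "s \<in> {1..Suc n}" "r < s"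
      then show "(\<alpha>(Suc n := j)) r < (\<alpha>(Suc n := j)) s"
        using lt[of r] strict_mono_onD[OF mono, of r s] by auto
    qed
    ultimately show "(case a of (j, \<alpha>) \<Rightarrow> \<alpha>(Suc n := j)) \<in> incr_maps (Suc n) {1..k}"
      by (simp add: incr_maps_def)
    show "f (case a of (j, \<alpha>) \<Rightarrow> \<alpha>(Suc n := j)) =
        (case a of (j, \<alpha>) \<Rightarrow> f (\<alpha>(Suc n := j)))"
      by simp
  next
    fix \<alpha> assume "\<alpha> \<in> incr_maps (Suc n) {1..k}"
    then have \<alpha>: "\<alpha> \<in> {1..Suc n} \<rightarrow>\<^sub>E {1..k}" and mono: "strict_mono_on {1..Suc n} \<alpha>"
      by (auto simp: incr_maps_def)
    show "(case (\<alpha> (Suc n), \<alpha>(Suc n := undefined)) of (j, \<alpha>) \<Rightarrow> \<alpha>(Suc n := j)) = \<alpha>"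
      by simp
    have ran: "\<alpha> i \<in> {1..k}" if "i \<in> {1..Suc n}" for i
      using PiE_mem[OF \<alpha> that] .
    have lt: "\<alpha> i < \<alpha> (Suc n)" if "i \<in> {1..n}" for i
      using strict_mono_onD[OF mono, of i "Suc n"] that by auto
    have "\<alpha>(Suc n := undefined) \<in> {1..n} \<rightarrow>\<^sub>E {1..\<alpha> (Suc n) - 1}"
    proof (rule PiE_I)
      fix i assume "i \<in> {1..n}"
      then show "(\<alpha>(Suc n := undefined)) i \<in> {1..\<alpha> (Suc n) - 1}"
        using lt[of i] ran[of i] by auto
    next
      fix i assume "i \<notin> {1..n}"
      then show "(\<alpha>(Suc n := undefined)) i = undefined"
        using \<alpha> by (auto simp: PiE_def extensional_def)
    qed
    moreover have "strict_mono_on {1..n} (\<alpha>(Suc n := undefined))"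
      using mono by (auto simp: strict_mono_on_def)
    ultimately show "(\<alpha> (Suc n), \<alpha>(Suc n := undefined)) \<in> (SIGMA j:{1..k}. incr_maps n {1..j - 1})"
      using ran[of "Suc n"] by (simp add: incr_maps_def)
  qed
  finally show ?thesis by simp
qed

section \<open>Compatible families of polynomials\<close>

text \<open>Families are arbitrary functions of \<open>k\<close> with pointwise operations. No
  compatibility is imposed, since the families that matter lie in spans of explicit ones.\<close>

definition fscale :: "rat \<Rightarrow> (nat \<Rightarrow> mpoly) \<Rightarrow> nat \<Rightarrow> mpoly" where
  "fscale c A = (\<lambda>k. Const c * A k)"

interpretation fam: vector_space fscale
  by standard (simp_all add: fscale_def fun_eq_iff Const_add Const_mult Const_1 algebra_simps)

lemma fam_linearI:
  assumes "\<And>A B. f (A + B) = f A + f B" "\<And>c A. f (fscale c A) = fscale c (f A)"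
  shows "Vector_Spaces.linear fscale fscale f"
  using assms
  by (auto simp: Vector_Spaces.linear_iff fam.vector_space_axioms)

lemma sum_fam_apply: "(\<Sum>i\<in>I. f i) k = (\<Sum>i\<in>I. f i k)"
  for f :: "'i \<Rightarrow> nat \<Rightarrow> mpoly"
  by (induction I rule: infinite_finite_induct) simp_all

lemma fam_span_image:
  assumes "Vector_Spaces.linear fscale fscale f" "\<And>A. A \<in> S \<Longrightarrow> f A \<in> fam.span T"
    and "A \<in> fam.span S"
  shows "f A \<in> fam.span T"
proof -
  interpret f: Vector_Spaces.linear fscale fscale f by fact
  have "f A \<in> f ` fam.span S"
    using assms(3) by blast
  also have "\<dots> = fam.span (f ` S)"
    by (rule f.span_image[symmetric])
  also have "\<dots> \<subseteq> fam.span T"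
    using assms(2) by (intro fam.span_minimal) auto
  finally show ?thesis .
qed

definition fam_t0 :: "nat \<Rightarrow> nat \<Rightarrow> mpoly" where
  "fam_t0 a = (\<lambda>k. Var 0 ^ a)"

text \<open>The operator C_b. The exponent \<open>Suc b\<close> supplies the factor t_j that
  elements of I_n carry, so \<open>b\<close> ranges over all naturals.\<close>

definition fam_mono :: "nat \<Rightarrow> (nat \<Rightarrow> mpoly) \<Rightarrow> nat \<Rightarrow> mpoly" where
  "fam_mono b A = (\<lambda>k. \<Sum>j=1..k. A (j - 1) * Var j ^ Suc b)"

text \<open>The operator T_b: the product formula with right factor t_0^b, whose sum over beta
  consists of the empty map only.\<close>

definition fam_odot :: "nat \<Rightarrow> (nat \<Rightarrow> mpoly) \<Rightarrow> nat \<Rightarrow> mpoly" where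
  "fam_odot b A = (\<lambda>k. \<Sum>j=1..k. A (j - 1) * Var j * (\<Sum>i=0..j. Var i) ^ b)"

definition fam_times :: "(nat \<Rightarrow> mpoly) \<Rightarrow> nat \<Rightarrow> mpoly" where
  "fam_times A = (\<lambda>k. (\<Sum>i=0..k. Var i) * A k)"

lemma linear_fam_mono: "Vector_Spaces.linear fscale fscale (fam_mono b)"
  by (rule fam_linearI)
    (simp_all add: fam_mono_def fscale_def fun_eq_iff distrib_right sum.distrib
      sum_distrib_left mult.assoc)

lemma linear_fam_odot: "Vector_Spaces.linear fscale fscale (fam_odot b)"
  by (rule fam_linearI)
    (simp_all add: fam_odot_def fscale_def fun_eq_iff distrib_right sum.distrib
      sum_distrib_left mult.assoc)

lemma linear_fam_times: "Vector_Spaces.linear fscale fscale fam_times"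
  by (rule fam_linearI) (simp_all add: fam_times_def fscale_def fun_eq_iff algebra_simps)

lemma fam_times_t0: "fam_times (fam_t0 a) = fam_t0 (Suc a) + fam_mono 0 (fam_t0 a)"
proof
  fix k
  show "fam_times (fam_t0 a) k = (fam_t0 (Suc a) + fam_mono 0 (fam_t0 a)) k"
    by (induction k) (simp_all add: fam_times_def fam_t0_def fam_mono_def algebra_simps)
qed

text \<open>In the summand for \<open>j\<close>, split p_k as p_(j-1) + t_j + (t_(j+1) + ... + t_k).
  The parts give the three terms: the new variable lies before, on or after t_j.\<close>

lemma fam_times_mono:
  "fam_times (fam_mono b A) =
    fam_mono b (fam_times A) + fam_mono (Suc b) A + fam_mono 0 (fam_mono b A)"
proof
  fix k
  show "fam_times (fam_mono b A) k =
    (fam_mono b (fam_times A) + fam_mono (Suc b) A + fam_mono 0 (fam_mono b A)) k"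
    by (induction k) (simp_all add: fam_times_def fam_mono_def algebra_simps)
qed

lemma fam_times_power: "(fam_times ^^ i) A k = (\<Sum>i=0..k. Var i) ^ i * A k"
  by (induction i) (simp_all add: fam_times_def mult.assoc)

text \<open>In the expansion of (p_(j-1) + t_j)^b, the power p_(j-1)^i has the same index as
  \<open>A (j - 1)\<close> and is absorbed as q^i, while t_j^(b-i) joins the factor t_j.\<close>

lemma fam_odot_eq:
  "fam_odot b A = (\<Sum>i\<le>b. fscale (of_nat (b choose i)) (fam_mono (b - i) ((fam_times ^^ i) A)))"
proof
  fix k
  have "A (j - 1) * Var j * (\<Sum>i=0..j. Var i) ^ b = (\<Sum>i\<le>b. of_nat (b choose i) *
      ((fam_times ^^ i) A (j - 1) * Var j ^ Suc (b - i)))" if "j \<in> {1..k}" for j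
  proof -
    from that obtain l where l: "j = Suc l" by (cases j) auto
    have "(\<Sum>i=0..j. Var i) ^ b = ((\<Sum>i=0..l. Var i) + Var j) ^ b"
      by (simp add: l)
    also have "\<dots> = (\<Sum>i\<le>b. of_nat (b choose i) * (\<Sum>i=0..l. Var i) ^ i * Var j ^ (b - i))"
      by (rule binomial_ring)
    finally show ?thesis
      by (simp add: l fam_times_power sum_distrib_left algebra_simps)
  qed
  then have "fam_odot b A k = (\<Sum>j=1..k. \<Sum>i\<le>b. of_nat (b choose i) *
      ((fam_times ^^ i) A (j - 1) * Var j ^ Suc (b - i)))"
    unfolding fam_odot_def by (rule sum.cong[OF refl])
  also have "\<dots> = (\<Sum>i\<le>b. \<Sum>j=1..k. of_nat (b choose i) *
      ((fam_times ^^ i) A (j - 1) * Var j ^ Suc (b - i)))"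
    by (rule sum.swap)
  also have "\<dots> = (\<Sum>i\<le>b. fscale (of_nat (b choose i)) (fam_mono (b - i) ((fam_times ^^ i) A))) k"
    by (simp add: fscale_def fam_mono_def Const_of_nat sum_distrib_left sum_fam_apply)
  finally show "fam_odot b A k = (\<Sum>i\<le>b. fscale (of_nat (b choose i)) (fam_mono (b - i) ((fam_times ^^ i) A))) k" .
qed


text \<open>
  Words are read from right to left, so that the head of a list carries the exponent of the
  variable with the largest index. The empty word is a junk case.
\<close>

fun fam_e :: "nat list \<Rightarrow> nat \<Rightarrow> mpoly" where
  "fam_e [] = 0"
| "fam_e [a] = fam_t0 a"
| "fam_e (b # c # w) = fam_mono b (fam_e (c # w))"

fun fam_v :: "nat list \<Rightarrow> nat \<Rightarrow> mpoly" where
  "fam_v [] = 0"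
| "fam_v [a] = fam_t0 a"
| "fam_v (b # c # w) = fam_odot b (fam_v (c # w))"

text \<open>
  The family of a word with letters \<open>w\<close> is homogeneous of degree
  \<open>sum_list w + length w - 1\<close>.
\<close>

definition words :: "nat \<Rightarrow> nat list set" where
  "words d = {w. w \<noteq> [] \<and> sum_list w + length w \<le> d}"

lemma finite_words: "finite (words d)"
proof (rule finite_subset)
  show "words d \<subseteq> {w. set w \<subseteq> {..d} \<and> length w \<le> d}"
    using member_le_sum_list by (fastforce simp: words_def)
  show "finite {w :: nat list. set w \<subseteq> {..d} \<and> length w \<le> d}"
    by (rule finite_lists_length_le) simp
qed

section \<open>Spans of the monomial families and of the word families\<close>

lemma fam_e_Cons: "w \<noteq> [] \<Longrightarrow> fam_e (b # w) = fam_mono b (fam_e w)"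
  by (cases w) auto

lemma fam_v_Cons: "w \<noteq> [] \<Longrightarrow> fam_v (b # w) = fam_odot b (fam_v w)"
  by (cases w) auto

lemma fam_mono_span_e:
  assumes "A \<in> fam.span (fam_e ` words d)" "d + b + 1 \<le> d'"
  shows "fam_mono b A \<in> fam.span (fam_e ` words d')"
proof (rule fam_span_image[OF linear_fam_mono _ assms(1)])
  fix B assume "B \<in> fam_e ` words d"
  then obtain w where w: "w \<in> words d" "B = fam_e w" by blast
  then have "b # w \<in> words d'" "fam_mono b B = fam_e (b # w)"
    using assms(2) by (auto simp: words_def fam_e_Cons)
  then show "fam_mono b B \<in> fam.span (fam_e ` words d')"
    by (auto intro: fam.span_base)
qed

text \<open>Each quasi-shuffle term either raises one letter by one or inserts a letter 0, and both
  add one to the bound.\<close>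

lemma fam_times_e:
  assumes "w \<in> words d"
  shows "fam_times (fam_e w) \<in> fam.span (fam_e ` words (Suc d))"
  using assms
proof (induction w arbitrary: d rule: fam_e.induct)
  case 1
  then show ?case by (simp add: words_def)
next
  case (2 a)
  then have "fam_e [Suc a] \<in> fam.span (fam_e ` words (Suc d))"
    "fam_e [0, a] \<in> fam.span (fam_e ` words (Suc d))"
    by (intro fam.span_base imageI; simp add: words_def)+
  then show ?case
    unfolding fam_e.simps fam_times_t0 by (rule fam.span_add)
next
  case (3 b c w)
  \<comment> \<open>The subtraction is exact: the letter \<open>b\<close> alone accounts for
    \<open>b + 1\<close> of the bound \<open>d\<close>.\<close>
  let ?d = "d - Suc b"
  have d: "c # w \<in> words ?d" "?d + b + 1 \<le> d"
    using 3(2) by (auto simp: words_def)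
  have "fam_times (fam_e (c # w)) \<in> fam.span (fam_e ` words (Suc ?d))"
    by (rule 3(1)) (fact d)
  then have "fam_mono b (fam_times (fam_e (c # w))) \<in> fam.span (fam_e ` words (Suc d))"
    by (rule fam_mono_span_e) (use d in simp)
  moreover have "fam_e (Suc b # c # w) \<in> fam.span (fam_e ` words (Suc d))"
    "fam_e (0 # b # c # w) \<in> fam.span (fam_e ` words (Suc d))"
    using 3(2) by (intro fam.span_base imageI; simp add: words_def)+
  ultimately show ?case
    unfolding fam_e.simps fam_times_mono by (intro fam.span_add)
qed

lemma fam_times_power_span_e:
  assumes "A \<in> fam.span (fam_e ` words d)"
  shows "(fam_times ^^ i) A \<in> fam.span (fam_e ` words (d + i))"
proof (induction i)
  case 0
  then show ?case using assms by simp
next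
  case (Suc i)
  have "fam_times ((fam_times ^^ i) A) \<in> fam.span (fam_e ` words (Suc (d + i)))"
    by (rule fam_span_image[OF linear_fam_times _ Suc]) (auto intro: fam_times_e)
  then show ?case by simp
qed

text \<open>Term \<open>i\<close> of \<open>fam_odot_eq\<close> gains \<open>i\<close> from the
  power of q and \<open>b - i + 1\<close> from C_(b-i), so all terms meet the same bound.\<close>

lemma fam_odot_span_e:
  assumes "A \<in> fam.span (fam_e ` words d)"
  shows "fam_odot b A \<in> fam.span (fam_e ` words (d + b + 1))"
  unfolding fam_odot_eq
proof (intro fam.span_sum fam.span_scale)
  fix i assume "i \<in> {..b}"
  then show "fam_mono (b - i) ((fam_times ^^ i) A) \<in> fam.span (fam_e ` words (d + b + 1))"
    by (intro fam_mono_span_e[OF fam_times_power_span_e[OF assms]]) simp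
qed

lemma fam_odot_span_v:
  assumes "A \<in> fam.span (fam_v ` words d)" "d + b + 1 \<le> d'"
  shows "fam_odot b A \<in> fam.span (fam_v ` words d')"
proof (rule fam_span_image[OF linear_fam_odot _ assms(1)])
  fix B assume "B \<in> fam_v ` words d"
  then obtain w where w: "w \<in> words d" "B = fam_v w" by blast
  then have "b # w \<in> words d'" "fam_odot b B = fam_v (b # w)"
    using assms(2) by (auto simp: words_def fam_v_Cons)
  then show "fam_odot b B \<in> fam.span (fam_v ` words d')"
    by (auto intro: fam.span_base)
qed

text \<open>C_b is T_b minus terms with smaller \<open>b\<close>. The outer induction on
  \<open>d\<close> rewrites the argument of T_b in word families; the inner induction on
  \<open>b\<close> treats the subtracted terms.\<close>

lemma fam_e_span_v: "fam_e ` words d \<subseteq> fam.span (fam_v ` words d)"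
proof (induction d rule: less_induct)
  case (less d)
  note outer = less.IH
  \<comment> \<open>\<open>m\<close> and \<open>A\<close> stay general, because the inner hypothesis
    is applied to q^i(A), whose bound is \<open>m + i\<close>.\<close>
  have mono: "fam_mono b A \<in> fam.span (fam_v ` words d)"
    if "A \<in> fam.span (fam_e ` words m)" "m + b + 1 \<le> d" for b m A
    using that
  proof (induction b arbitrary: m A rule: less_induct)
    case (less b)
    \<comment> \<open>The premise \<open>m + b + 1 \<le> d\<close> forces \<open>m < d\<close>, so
      the outer hypothesis applies.\<close>
    have "fam.span (fam_e ` words m) \<subseteq> fam.span (fam_v ` words m)"
      using less.prems by (intro fam.span_minimal outer) auto
    then have odot: "fam_odot b A \<in> fam.span (fam_v ` words d)"
      using less.prems fam_odot_span_v by blast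
    have rest: "(\<Sum>i=1..b. fscale (of_nat (b choose i)) (fam_mono (b - i) ((fam_times ^^ i) A)))
        \<in> fam.span (fam_v ` words d)"
    proof (intro fam.span_sum fam.span_scale)
      fix i assume i: "i \<in> {1..b}"
      \<comment> \<open>Passing from \<open>b\<close> to \<open>b - i\<close> and from
        \<open>m\<close> to \<open>m + i\<close> leaves \<open>m + b + 1\<close> unchanged.\<close>
      show "fam_mono (b - i) ((fam_times ^^ i) A) \<in> fam.span (fam_v ` words d)"
        by (rule less.IH[OF _ fam_times_power_span_e[OF less.prems(1)]])
          (use i less.prems(2) in auto)
    qed
    \<comment> \<open>The term \<open>i = 0\<close> has binomial coefficient 1 and no power of q: it
      is C_b(A) itself, and the expansion is solved for it.\<close>
    have "{..b} = insert 0 {1..b}" by auto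
    then have "fam_odot b A = fam_mono b A +
        (\<Sum>i=1..b. fscale (of_nat (b choose i)) (fam_mono (b - i) ((fam_times ^^ i) A)))"
      by (simp only: fam_odot_eq) (simp add: fun_eq_iff fscale_def Const_1)
    then have "fam_mono b A = fam_odot b A -
        (\<Sum>i=1..b. fscale (of_nat (b choose i)) (fam_mono (b - i) ((fam_times ^^ i) A)))"
      by (simp only: add_diff_cancel_right')
    then show ?case
      using fam.span_diff[OF odot rest] by (simp only:)
  qed
  show ?case
  proof (rule image_subsetI)
    fix w assume w: "w \<in> words d"
    consider "w = []" | a where "w = [a]" | b c u where "w = b # c # u"
      by (metis neq_Nil_conv)
    then show "fam_e w \<in> fam.span (fam_v ` words d)"
    proof cases
      case 1
      then show ?thesis using w by (simp add: words_def)
    next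
      case 2
      then have "fam_e w = fam_v w" by simp
      then show ?thesis using w by (auto intro: fam.span_base)
    next
      case 3
      have "fam_e (c # u) \<in> fam.span (fam_e ` words (d - Suc b))"
        using w 3 by (intro fam.span_base imageI) (auto simp: words_def)
      from mono[OF this, of b] show ?thesis
        using w 3 by (auto simp: words_def)
    qed
  qed
qed

section \<open>Coefficients\<close>

text \<open>For nonempty \<open>w\<close>, the packed exponent vector in t_0,...,t_n with n =
  \<open>length w - 1\<close>, coming from the inclusion of [1,n] in [1,k]. Its coefficient will
  detect \<open>w\<close> among all monomial families.\<close>

fun expo :: "nat list \<Rightarrow> (nat \<Rightarrow>\<^sub>0 nat)" where
  "expo [] = 0"
| "expo [a] = Poly_Mapping.single 0 a"
| "expo (b # c # w) = expo (c # w) + Poly_Mapping.single (length (c # w)) (Suc b)"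

lemma keys_expo: "Poly_Mapping.keys (expo w) \<subseteq> {..<length w}"
proof (induction w rule: expo.induct)
  case (3 b c w)
  then show ?case
    using Poly_Mapping.keys_add[of "expo (c # w)"
        "Poly_Mapping.single (length (c # w)) (Suc b)"]
    by fastforce
qed simp_all

lemma lookup_expo_ge: "length w \<le> i \<Longrightarrow> Poly_Mapping.lookup (expo w) i = 0"
  using keys_expo[of w] by (force simp: in_keys_iff)

lemma poly_mapping_eq_sum:
  "p = (\<Sum>m\<in>Poly_Mapping.keys p. Poly_Mapping.single m (Poly_Mapping.lookup p m))"
proof (rule poly_mapping_eqI)
  fix m
  show "Poly_Mapping.lookup p m = Poly_Mapping.lookup
      (\<Sum>m\<in>Poly_Mapping.keys p. Poly_Mapping.single m (Poly_Mapping.lookup p m)) m"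
    by (simp add: lookup_sum lookup_single when_def in_keys_iff)
qed

lemma lookup_mult_monomial:
  fixes p :: mpoly
  shows "Poly_Mapping.lookup (p * Poly_Mapping.single s 1) (m + s) = Poly_Mapping.lookup p m"
proof -
  have "p * Poly_Mapping.single s 1 =
      (\<Sum>l\<in>Poly_Mapping.keys p. Poly_Mapping.single (l + s) (Poly_Mapping.lookup p l))"
    by (subst (1) poly_mapping_eq_sum[of p]) (simp add: sum_distrib_right mult_single)
  then show ?thesis
    by (simp add: lookup_sum lookup_single when_def in_keys_iff)
qed

lemma keys_mult_monomial:
  fixes p :: mpoly
  assumes "m \<in> Poly_Mapping.keys (p * Poly_Mapping.single s 1)"
  obtains l where "l \<in> Poly_Mapping.keys p" "m = l + s"
  using assms keys_mult[of p "Poly_Mapping.single s 1"] by auto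

lemma keys_sum_subset:
  "Poly_Mapping.keys (sum f I) \<subseteq> (\<Union>i\<in>I. Poly_Mapping.keys (f i))"
proof (induction I rule: infinite_finite_induct)
  case (insert i I)
  then show ?case
    using Poly_Mapping.keys_add[of "f i" "sum f I"] by auto
qed simp_all

lemma keys_fam_e:
  assumes "m \<in> Poly_Mapping.keys (fam_e w k)"
  shows "Poly_Mapping.keys m \<subseteq> {..k}"
  using assms
proof (induction w arbitrary: k m rule: fam_e.induct)
  case (2 a)
  then show ?case by (auto simp: fam_t0_def Var_power split: if_splits)
next
  case (3 b c w)
  obtain j where j: "j \<in> {1..k}"
    and "m \<in> Poly_Mapping.keys (fam_e (c # w) (j - 1) * Var j ^ Suc b)"
    using 3(2) keys_sum_subset by (fastforce simp: fam_mono_def simp del: power_Suc)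
  then obtain l where l: "l \<in> Poly_Mapping.keys (fam_e (c # w) (j - 1))"
    "m = l + Poly_Mapping.single j (Suc b)"
    by (auto simp: Var_power simp del: power_Suc elim: keys_mult_monomial)
  show ?case
    using 3(1)[OF l(1)] j Poly_Mapping.keys_add[of l "Poly_Mapping.single j (Suc b)"]
    unfolding l(2) by fastforce
qed simp

text \<open>The factor at \<open>j - 1\<close> involves only t_0,...,t_(j-1), so t_j is the largest
  variable and comes from the explicit power alone. For \<open>j = 0\<close> the truncated index
  \<open>j - 1\<close> would let t_0 occur in both factors.\<close>

lemma lookup_fam_mono_term:
  assumes "Poly_Mapping.lookup (fam_e w (j - 1) * Var j ^ Suc b) m \<noteq> 0" "j \<ge> 1"
  shows "Poly_Mapping.lookup m j = Suc b" "\<And>i. i > j \<Longrightarrow> Poly_Mapping.lookup m i = 0"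
proof -
  have "m \<in> Poly_Mapping.keys (fam_e w (j - 1) * Var j ^ Suc b)"
    using assms by (simp add: in_keys_iff)
  then obtain l where l: "l \<in> Poly_Mapping.keys (fam_e w (j - 1))"
    "m = l + Poly_Mapping.single j (Suc b)"
    by (auto simp: Var_power simp del: power_Suc elim: keys_mult_monomial)
  have "Poly_Mapping.lookup l i = 0" if "i \<ge> j" for i
    using keys_fam_e[OF l(1)] that assms(2) by (force simp: in_keys_iff)
  then show "Poly_Mapping.lookup m j = Suc b" "\<And>i. i > j \<Longrightarrow> Poly_Mapping.lookup m i = 0"
    by (simp_all add: l(2) lookup_add lookup_single when_def)
qed

text \<open>Packed monomials are dual to monomial families. The largest variable fixes the summand,
  its exponent fixes the head letter, and cancelling it leaves the claim for the tails. The bound on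
  \<open>length w\<close> makes all variables of \<open>expo w\<close> available at level
  \<open>k\<close>.\<close>

lemma lookup_fam_e:
  assumes "w \<noteq> []" "w' \<noteq> []" "length w \<le> Suc k"
  shows "Poly_Mapping.lookup (fam_e w' k) (expo w) = (if w = w' then 1 else 0)"
  using assms
proof (induction w' arbitrary: w k rule: fam_e.induct)
  case 1
  then show ?case by simp
next
  case (2 a)
  show ?case
  proof (cases w rule: expo.cases)
    case (3 b c u)
    have "Poly_Mapping.lookup (expo w) (length (c # u)) = Suc b"
      using 3 by (simp add: lookup_add lookup_expo_ge)
    then have "expo w \<noteq> Poly_Mapping.single 0 a"
      by (auto simp: lookup_single when_def)
    then show ?thesis
      using 3 by (simp add: fam_t0_def Var_power lookup_single when_def)
  qed (use 2 in \<open>auto simp: fam_t0_def Var_power lookup_single when_def dest: arg_cong[of _ _ "\<lambda>p. Poly_Mapping.lookup p 0"]\<close>)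
next
  case (3 b c' u')
  let ?t = "\<lambda>j. Poly_Mapping.lookup (fam_e (c' # u') (j - 1) * Var j ^ Suc b) (expo w)"
  have eq: "Poly_Mapping.lookup (fam_e (b # c' # u') k) (expo w) = (\<Sum>j=1..k. ?t j)"
    by (simp add: fam_mono_def lookup_sum del: power_Suc)
  show ?case
  proof (cases w rule: expo.cases)
    case 1
    then show ?thesis using 3 by simp
  next
    case (2 a)
    have "?t j = 0" if "j \<in> {1..k}" for j
      using lookup_fam_mono_term(1)[of "c' # u'" j b "expo w"] that 2
      by (auto simp: lookup_single when_def)
    then show ?thesis
      unfolding eq using 2 by simp
  next
    case w: (3 x c u)
    let ?n = "length (c # u)"
    have x: "Poly_Mapping.lookup (expo w) ?n = Suc x"
      using w by (simp add: lookup_add lookup_expo_ge)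
    \<comment> \<open>A nonzero summand \<open>j\<close> has t_j as largest variable, with exponent
      \<open>Suc b\<close>; in \<open>expo w\<close> the largest index is \<open>?n\<close>, with
      exponent \<open>Suc x\<close>.\<close>
    have t: "j = ?n \<and> x = b" if "j \<in> {1..k}" "?t j \<noteq> 0" for j
    proof -
      have j: "Poly_Mapping.lookup (expo w) j = Suc b"
        "\<And>i. i > j \<Longrightarrow> Poly_Mapping.lookup (expo w) i = 0"
        using lookup_fam_mono_term[of "c' # u'" j b "expo w"] that by auto
      have "\<not> j < ?n" using j(2) x by force
      moreover have "\<not> j > ?n"
        using j(1) lookup_expo_ge[of w j] w by force
      ultimately have "j = ?n" by simp
      then show ?thesis using j(1) x by simp
    qed
    show ?thesis
    proof (cases "x = b")
      case False
      then have "(\<Sum>j=1..k. ?t j) = 0"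
        using t by (intro sum.neutral) blast
      then show ?thesis using eq w False by simp
    next
      case True
      have "(\<Sum>j=1..k. ?t j) = (\<Sum>j\<in>{?n}. ?t j)"
        using t 3(4) w by (intro sum.mono_neutral_right) auto
      \<comment> \<open>Cancelling the last power descends to level \<open>?n - 1\<close>, where the
        length condition for \<open>c # u\<close> holds with equality.\<close>
      also have "\<dots> = Poly_Mapping.lookup (fam_e (c' # u') (?n - 1)) (expo (c # u))"
        using w True lookup_mult_monomial
        by (simp add: Var_power del: power_Suc)
      also have "\<dots> = (if c # u = c' # u' then 1 else 0)"
        by (rule 3(1)) simp_all
      finally show ?thesis using eq w True by simp
    qed
  qed
qed

lemma lookup_fam_e':
  assumes "w \<noteq> []" "w' \<noteq> []"
  shows "Poly_Mapping.lookup (fam_e w' (length w)) (expo w) = (if w = w' then 1 else 0)"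
  using assms by (intro lookup_fam_e) auto

section \<open>Linear independence by coefficients and by counting\<close>

lemma inj_fam_e: "inj_on fam_e {w. w \<noteq> []}"
proof (rule inj_onI)
  fix w w' assume "w \<in> {w. w \<noteq> []}" "w' \<in> {w. w \<noteq> []}" "fam_e w = fam_e w'"
  then show "w = w'"
    using lookup_fam_e'[of w w] lookup_fam_e'[of w w'] by (auto split: if_splits)
qed

text \<open>The coefficients at packed monomials are dual functionals; applied to a linear relation,
  each isolates one scalar.\<close>

lemma independent_fam_e: "fam.independent (fam_e ` {w. w \<noteq> []})"
  unfolding fam.independent_explicit_module
proof (intro allI impI)
  fix t u v
  assume fin: "finite t" and t: "t \<subseteq> fam_e ` {w. w \<noteq> []}"
    and 0: "(\<Sum>v\<in>t. fscale (u v) v) = 0" and v: "v \<in> t"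
  obtain w where w: "w \<noteq> []" "v = fam_e w" using t v by blast
  have "0 = Poly_Mapping.lookup ((\<Sum>v\<in>t. fscale (u v) v) (length w)) (expo w)"
    unfolding 0 by simp
  also have "\<dots> = (\<Sum>v'\<in>t. u v' * Poly_Mapping.lookup (v' (length w)) (expo w))"
    by (simp add: sum_fam_apply fscale_def lookup_sum lookup_Const_mult)
  also have "\<dots> = (\<Sum>v'\<in>t. if v' = v then u v else 0)"
  proof (rule sum.cong[OF refl])
    fix v' assume "v' \<in> t"
    then obtain w' where "w' \<noteq> []" "v' = fam_e w'" using t by blast
    then show "u v' * Poly_Mapping.lookup (v' (length w)) (expo w) = (if v' = v then u v else 0)"
      using w inj_onD[OF inj_fam_e, of w w'] by (auto simp: lookup_fam_e')
  qed
  also have "\<dots> = u v" using fin v by simp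
  finally show "u v = 0" by simp
qed

text \<open>The monomial families of \<open>words d\<close> are independent and pairwise distinct,
  which bounds the size of any set spanning them from below. Independence of the word families rests
  on this count.\<close>

lemma card_words_le:
  assumes "finite T" "fam_e ` words d \<subseteq> fam.span T"
  shows "card (words d) \<le> card T"
proof -
  have sub: "words d \<subseteq> {w. w \<noteq> []}" by (auto simp: words_def)
  have "fam.independent (fam_e ` words d)"
    by (rule fam.independent_mono[OF independent_fam_e image_mono[OF sub]])
  then have "card (fam_e ` words d) \<le> card T"
    using fam.independent_span_bound[OF assms(1) _ assms(2)] by simp
  then show ?thesis
    by (simp add: card_image inj_on_subset[OF inj_fam_e sub])
qed

text \<open>The image of \<open>words d\<close> spans the monomial families of the same bound, so it
  has no fewer elements than \<open>words d\<close>; on a finite set this forces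
  injectivity.\<close>

lemma inj_fam_v_words: "inj_on fam_v (words d)"
  using card_words_le[OF _ fam_e_span_v, of d] card_image_le[OF finite_words, of fam_v d]
  by (intro eq_card_imp_inj_on) (auto simp: finite_words intro: antisym)

text \<open>Dropping a redundant family would leave the span unchanged with fewer elements than
  \<open>words d\<close>, against \<open>card_words_le\<close>.\<close>

lemma independent_fam_v_words: "fam.independent (fam_v ` words d)"
proof
  let ?S = "fam_v ` words d"
  assume "fam.dependent ?S"
  then obtain a where a: "a \<in> ?S" "a \<in> fam.span (?S - {a})"
    unfolding fam.dependent_def by blast
  have "?S \<subseteq> fam.span (?S - {a})"
    using a(2) by (auto intro: fam.span_base)
  then have "fam.span ?S \<subseteq> fam.span (?S - {a})"
    by (intro fam.span_minimal) auto
  then have "card (words d) \<le> card (?S - {a})"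
    using fam_e_span_v[of d] by (intro card_words_le) (auto simp: finite_words)
  also have "\<dots> < card ?S"
    using a(1) by (intro psubset_card_mono) (auto simp: finite_words)
  also have "\<dots> \<le> card (words d)"
    by (rule card_image_le[OF finite_words])
  finally show False by simp
qed

lemma inj_fam_v: "inj_on fam_v {w. w \<noteq> []}"
proof (rule inj_onI)
  fix w w' assume w: "w \<in> {w. w \<noteq> []}" "w' \<in> {w. w \<noteq> []}" "fam_v w = fam_v w'"
  let ?d = "max (sum_list w + length w) (sum_list w' + length w')"
  have "w \<in> words ?d" "w' \<in> words ?d" using w by (auto simp: words_def)
  then show "w = w'" using inj_onD[OF inj_fam_v_words w(3)] by blast
qed

text \<open>A linear relation involves finitely many words, and these lie in one
  \<open>words d\<close>, for instance with the sum of their sizes as \<open>d\<close>.\<close>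

lemma independent_fam_v: "fam.independent (fam_v ` {w. w \<noteq> []})"
  unfolding fam.independent_explicit_module
proof (intro allI impI)
  fix t u v
  assume fin: "finite t" and t: "t \<subseteq> fam_v ` {w. w \<noteq> []}"
    and 0: "(\<Sum>v\<in>t. fscale (u v) v) = 0" and v: "v \<in> t"
  obtain C where C: "C \<subseteq> {w. w \<noteq> []}" "finite C" "t = fam_v ` C"
    using finite_subset_image[OF fin t] by blast
  have "C \<subseteq> words (\<Sum>w\<in>C. sum_list w + length w)"
    using C member_le_sum[of _ C "\<lambda>w. sum_list w + length w"] by (fastforce simp: words_def)
  then have "t \<subseteq> fam_v ` words (\<Sum>w\<in>C. sum_list w + length w)"
    using C by blast
  then show "u v = 0"
    by (rule fam.independentD[OF independent_fam_v_words fin _ 0 v])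
qed

section \<open>The canonical map on the monomial basis\<close>

text \<open>The index \<open>k = 0\<close> is included: the operators evaluate families at
  \<open>j - 1\<close>, which is 0 for \<open>j = 1\<close>.\<close>

definition fam_canon :: "mpoly_seq \<Rightarrow> nat \<Rightarrow> mpoly" where
  "fam_canon F = (\<lambda>k. canon k F)"

lemma linear_fam_canon: "Vector_Spaces.linear qscale fscale fam_canon"
  by (auto simp: Vector_Spaces.linear_iff fam.vector_space_axioms Rt0.vector_space_axioms
      fam_canon_def canon_def fscale_def fun_eq_iff incr_sum_add incr_sum_qscale)

interpretation fam_canon: Vector_Spaces.linear qscale fscale fam_canon
  by (rule linear_fam_canon)

text \<open>For nonempty \<open>w\<close>, these are the monomial basis elements of R[t_0], with n =
  \<open>length w - 1\<close> as the index of the summand.\<close>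

definition mono_seq :: "nat list \<Rightarrow> mpoly_seq" where
  "mono_seq w = Poly_Mapping.single (length w - 1) (Poly_Mapping.single (expo w) 1)"

text \<open>By \<open>sum_incr_maps_Suc\<close>, the last value of the increasing map becomes the
  summation index of C_b, so the head letter belongs to the last variable.\<close>

lemma fam_canon_mono_seq:
  assumes "w \<noteq> []"
  shows "fam_canon (mono_seq w) = fam_e w"
proof
  fix k
  have "(\<Sum>\<alpha>\<in>incr_maps (length w - 1) {1..k}.
      msubst (\<lambda>i. if i = 0 then Var 0 else Var (\<alpha> i)) (expo w)) = fam_e w k"
    using assms
  proof (induction w arbitrary: k rule: expo.induct)
    case (2 a)
    then show ?case by (simp add: incr_maps_0 msubst_single fam_t0_def)
  next
    case (3 b c w)
    \<comment> \<open>The monomial of the tail does not contain the variable of index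
      \<open>Suc (length w)\<close>, so the appended value does not affect it.\<close>
    have cong: "msubst (\<lambda>i. if i = 0 then Var 0 else Var ((\<alpha>(Suc (length w) := j)) i)) (expo (c # w))
        = msubst (\<lambda>i. if i = 0 then Var 0 else Var (\<alpha> i)) (expo (c # w))" for \<alpha> j
      by (rule msubst_cong) (use keys_expo[of "c # w"] in fastforce)
    have "(\<Sum>\<alpha>\<in>incr_maps (Suc (length w)) {1..k}.
        msubst (\<lambda>i. if i = 0 then Var 0 else Var (\<alpha> i)) (expo (b # c # w))) =
      (\<Sum>j=1..k. \<Sum>\<alpha>\<in>incr_maps (length w) {1..j - 1}.
        msubst (\<lambda>i. if i = 0 then Var 0 else Var (\<alpha> i)) (expo (c # w)) * Var j ^ Suc b)"
      by (simp only: sum_incr_maps_Suc expo.simps msubst_add cong msubst_single) simp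
    also have "\<dots> = fam_e (b # c # w) k"
      using 3(1) by (simp add: fam_mono_def flip: sum_distrib_right)
    finally show ?case by simp
  qed simp
  then show "fam_canon (mono_seq w) k = fam_e w k"
    by (simp add: fam_canon_def canon_def mono_seq_def incr_sum_monomial)
qed

section \<open>Monomials spanning R[t_0]\<close>

text \<open>Divisibility by t_1...t_n and the restriction to t_0,...,t_n can both be tested monomial
  by monomial.\<close>

lemma I0_iff:
  "p \<in> I0 n \<longleftrightarrow> (\<forall>m\<in>Poly_Mapping.keys p.
     Poly_Mapping.keys m \<subseteq> {0..n} \<and> {1..n} \<subseteq> Poly_Mapping.keys m)"
proof -
  define M :: "nat \<Rightarrow>\<^sub>0 nat" where "M = (\<Sum>i=1..n. Poly_Mapping.single i 1)"
  have M: "Poly_Mapping.lookup M i = (if i \<in> {1..n} then 1 else 0)" for i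
    by (simp add: M_def lookup_sum lookup_single when_def)
  have prod: "(\<Prod>i\<in>I. Var i) = Poly_Mapping.single (\<Sum>i\<in>I. Poly_Mapping.single i 1) 1"
    for I :: "nat set"
    by (induction I rule: infinite_finite_induct) (simp_all add: Var_def mult_single)
  show ?thesis
  proof
    assume "p \<in> I0 n"
    then obtain q where q: "p = q * Poly_Mapping.single M 1" "vars q \<subseteq> {0..n}"
      unfolding I0_def prod M_def by (auto simp: mult.commute)
    show "\<forall>m\<in>Poly_Mapping.keys p. Poly_Mapping.keys m \<subseteq> {0..n} \<and> {1..n} \<subseteq> Poly_Mapping.keys m"
    proof
      fix m assume "m \<in> Poly_Mapping.keys p"
      then obtain l where l: "l \<in> Poly_Mapping.keys q" "m = l + M"
        unfolding q(1) by (rule keys_mult_monomial)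
      then have "Poly_Mapping.keys l \<subseteq> {0..n}"
        using q(2) by (auto simp: vars_def)
      moreover have "Poly_Mapping.keys M = {1..n}"
        by (rule set_eqI, unfold in_keys_iff M) simp
      moreover have "Poly_Mapping.keys m = Poly_Mapping.keys l \<union> Poly_Mapping.keys M"
        by (auto simp: l(2) in_keys_iff lookup_add)
      ultimately show "Poly_Mapping.keys m \<subseteq> {0..n} \<and> {1..n} \<subseteq> Poly_Mapping.keys m"
        by auto
    qed
  next
    assume *: "\<forall>m\<in>Poly_Mapping.keys p.
      Poly_Mapping.keys m \<subseteq> {0..n} \<and> {1..n} \<subseteq> Poly_Mapping.keys m"
    \<comment> \<open>The quotient of \<open>p\<close> by t_1...t_n, whose exponent vector is
      \<open>M\<close>. The truncated subtraction is exact by \<open>M_le\<close>.\<close>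
    define q where "q = (\<Sum>m\<in>Poly_Mapping.keys p.
      Poly_Mapping.single (m - M) (Poly_Mapping.lookup p m))"
    have M_le: "M + (m - M) = m" if "m \<in> Poly_Mapping.keys p" for m
    proof (rule poly_mapping_eqI)
      fix i
      have "Poly_Mapping.lookup M i \<le> Poly_Mapping.lookup m i"
      proof (cases "i \<in> {1..n}")
        case True
        then have "i \<in> Poly_Mapping.keys m" using * that by blast
        then show ?thesis by (simp add: M in_keys_iff)
      next
        case False
        then show ?thesis by (simp only: M if_False zero_le)
      qed
      then show "Poly_Mapping.lookup (M + (m - M)) i = Poly_Mapping.lookup m i"
        by (simp add: lookup_add lookup_minus)
    qed
    have "p = (\<Prod>i=1..n. Var i) * q"
    proof -
      have "(\<Prod>i=1..n. Var i) * q = (\<Sum>m\<in>Poly_Mapping.keys p.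
          Poly_Mapping.single (M + (m - M)) (Poly_Mapping.lookup p m))"
        unfolding prod q_def M_def[symmetric] by (simp add: sum_distrib_left mult_single)
      also have "\<dots> = (\<Sum>m\<in>Poly_Mapping.keys p. Poly_Mapping.single m (Poly_Mapping.lookup p m))"
        by (rule sum.cong[OF refl]) (simp only: M_le)
      also have "\<dots> = p" by (rule poly_mapping_eq_sum[symmetric])
      finally show ?thesis by (rule sym)
    qed
    moreover have "vars q \<subseteq> {0..n}"
    proof -
      have "Poly_Mapping.keys m' \<subseteq> {0..n}" if m': "m' \<in> Poly_Mapping.keys q" for m'
      proof -
        have "m' \<in> (\<Union>m\<in>Poly_Mapping.keys p.
            Poly_Mapping.keys (Poly_Mapping.single (m - M) (Poly_Mapping.lookup p m)))"
          by (rule subsetD[OF keys_sum_subset m'[unfolded q_def]])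
        then obtain m where "m \<in> Poly_Mapping.keys p" "m' = m - M"
          by (auto split: if_splits)
        moreover from this have "Poly_Mapping.keys m' \<subseteq> Poly_Mapping.keys m"
          by (auto simp: in_keys_iff lookup_minus)
        ultimately show ?thesis using * by blast
      qed
      then show ?thesis by (auto simp: vars_def)
    qed
    ultimately show "p \<in> I0 n" unfolding I0_def by blast
  qed
qed

lemma Rt0_D:
  assumes "F \<in> Rt0" "m \<in> Poly_Mapping.keys (Poly_Mapping.lookup F n)"
  shows "Poly_Mapping.keys m \<subseteq> {0..n} \<and> {1..n} \<subseteq> Poly_Mapping.keys m"
proof -
  have "Poly_Mapping.lookup F n \<in> I0 n" using assms(1) by (simp add: Rt0_def)
  then show ?thesis using assms(2) unfolding I0_iff by (rule bspec)
qed

lemma subspace_Rt0: "Rt0.subspace Rt0"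
proof (rule Rt0.subspaceI)
  show "0 \<in> Rt0" by (simp add: Rt0_def I0_iff)
next
  fix F G assume F: "F \<in> Rt0" and G: "G \<in> Rt0"
  have "Poly_Mapping.lookup F n + Poly_Mapping.lookup G n \<in> I0 n" for n
    unfolding I0_iff
  proof
    fix m assume "m \<in> Poly_Mapping.keys (Poly_Mapping.lookup F n + Poly_Mapping.lookup G n)"
    then have "m \<in> Poly_Mapping.keys (Poly_Mapping.lookup F n) \<or>
        m \<in> Poly_Mapping.keys (Poly_Mapping.lookup G n)"
      by (rule subsetD[OF Poly_Mapping.keys_add, THEN UnE]) simp_all
    then show "Poly_Mapping.keys m \<subseteq> {0..n} \<and> {1..n} \<subseteq> Poly_Mapping.keys m"
      using Rt0_D[OF F] Rt0_D[OF G] by blast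
  qed
  then show "F + G \<in> Rt0"
    by (simp add: Rt0_def lookup_add)
next
  fix c F assume F: "F \<in> Rt0"
  have "Const c * Poly_Mapping.lookup F n \<in> I0 n" for n
    unfolding I0_iff
  proof
    fix m assume "m \<in> Poly_Mapping.keys (Const c * Poly_Mapping.lookup F n)"
    then have "m \<in> Poly_Mapping.keys (Poly_Mapping.lookup F n)"
      by (simp add: in_keys_iff lookup_Const_mult)
    then show "Poly_Mapping.keys m \<subseteq> {0..n} \<and> {1..n} \<subseteq> Poly_Mapping.keys m"
      by (rule Rt0_D[OF F])
  qed
  then show "qscale c F \<in> Rt0"
    by (simp add: Rt0_def lookup_qscale)
qed

lemma expo_keys_superset: "{1..<length w} \<subseteq> Poly_Mapping.keys (expo w)"
proof (induction w rule: expo.induct)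
  case (3 b c w)
  have "i \<in> Poly_Mapping.keys (expo (b # c # w))" if "i \<in> {1..<length (b # c # w)}" for i
    using subsetD[OF 3, of i] that
    by (cases "i = length (c # w)") (auto simp: in_keys_iff lookup_add)
  then show ?case by blast
qed simp_all

lemma mono_seq_in_Rt0:
  assumes "w \<noteq> []"
  shows "mono_seq w \<in> Rt0"
proof -
  obtain n where n: "length w = Suc n" using assms by (cases w) simp_all
  have "Poly_Mapping.keys (expo w) \<subseteq> {0..n}"
    using keys_expo[of w] by (simp add: n atLeast0AtMost lessThan_Suc_atMost)
  moreover have "{1..n} \<subseteq> Poly_Mapping.keys (expo w)"
    using expo_keys_superset[of w] by (simp only: n atLeastLessThanSuc_atLeastAtMost)
  ultimately have "Poly_Mapping.single (expo w) 1 \<in> I0 n"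
    by (simp add: I0_iff)
  moreover have "0 \<in> I0 i" for i
    by (simp add: I0_iff)
  ultimately show ?thesis
    by (simp add: Rt0_def mono_seq_def lookup_single when_def n)
qed

text \<open>Peel off the variable of largest index. As all of t_1,...,t_n occur, its exponent is
  positive and its predecessor serves as the head letter; only t_0 may have exponent 0.\<close>

lemma expo_surj:
  assumes "Poly_Mapping.keys m \<subseteq> {0..n}" "{1..n} \<subseteq> Poly_Mapping.keys m"
  obtains w where "w \<noteq> []" "length w = Suc n" "expo w = m"
  using assms
proof (induction n arbitrary: m thesis)
  case 0
  have "expo [Poly_Mapping.lookup m 0] = m"
    using 0(2) by (intro poly_mapping_eqI) (auto simp: lookup_single when_def in_keys_iff)
  then show ?case using 0(1)[of "[Poly_Mapping.lookup m 0]"] by simp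
next
  case (Suc n)
  define e where "e = Poly_Mapping.lookup m (Suc n)"
  define m' where "m' = m - Poly_Mapping.single (Suc n) e"
  have lookup_m': "Poly_Mapping.lookup m' i = (if i = Suc n then 0 else Poly_Mapping.lookup m i)" for i
    by (simp add: m'_def lookup_minus lookup_single when_def e_def)
  have "Poly_Mapping.keys m' \<subseteq> {0..n}"
  proof
    fix i assume "i \<in> Poly_Mapping.keys m'"
    then have "i \<noteq> Suc n" "i \<in> Poly_Mapping.keys m"
      by (simp_all only: in_keys_iff lookup_m' if_True if_False split: if_splits) auto
    then show "i \<in> {0..n}"
      using subsetD[OF Suc.prems(2), of i] by simp
  qed
  moreover have "{1..n} \<subseteq> Poly_Mapping.keys m'"
  proof
    fix i assume "i \<in> {1..n}"
    then show "i \<in> Poly_Mapping.keys m'"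
      using subsetD[OF Suc.prems(3), of i] by (simp add: in_keys_iff lookup_m')
  qed
  ultimately obtain w where w: "w \<noteq> []" "length w = Suc n" "expo w = m'"
    using Suc.IH by blast
  have "e > 0"
    using subsetD[OF Suc.prems(3), of "Suc n"] by (simp add: e_def in_keys_iff)
  have "expo ((e - 1) # w) = m' + Poly_Mapping.single (Suc n) e"
  proof -
    obtain c u where "w = c # u" using w(1) by (cases w) simp_all
    then show ?thesis using w \<open>e > 0\<close> by simp
  qed
  also have "\<dots> = m"
    by (rule poly_mapping_eqI) (simp add: lookup_add lookup_m' lookup_single when_def e_def)
  finally have "expo ((e - 1) # w) = m" .
  then show ?case
    by (intro Suc.prems(1)[of "(e - 1) # w"]) (simp_all add: w(2))
qed

lemma span_mono_seq: "Rt0.span (mono_seq ` {w. w \<noteq> []}) = Rt0"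
proof (rule Rt0.span_subspace[OF _ _ subspace_Rt0])
  show "mono_seq ` {w. w \<noteq> []} \<subseteq> Rt0" using mono_seq_in_Rt0 by blast
  show "Rt0 \<subseteq> Rt0.span (mono_seq ` {w. w \<noteq> []})"
  proof
    fix F assume F: "F \<in> Rt0"
    have single: "Poly_Mapping.single n p = (\<Sum>m\<in>Poly_Mapping.keys p.
        qscale (Poly_Mapping.lookup p m) (Poly_Mapping.single n (Poly_Mapping.single m 1)))"
      for n and p :: mpoly
    proof (rule poly_mapping_eqI)
      fix l
      have "(\<Sum>m\<in>Poly_Mapping.keys p.
          Const (Poly_Mapping.lookup p m) * Poly_Mapping.single m 1) = p"
        by (simp add: Const_def mult_single flip: poly_mapping_eq_sum)
      then show "Poly_Mapping.lookup (Poly_Mapping.single n p) l =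
          Poly_Mapping.lookup (\<Sum>m\<in>Poly_Mapping.keys p. qscale (Poly_Mapping.lookup p m)
            (Poly_Mapping.single n (Poly_Mapping.single m 1))) l"
        by (simp add: lookup_sum lookup_qscale lookup_single when_def)
    qed
    have "F = (\<Sum>n\<in>Poly_Mapping.keys F. Poly_Mapping.single n (Poly_Mapping.lookup F n))"
      by (rule poly_mapping_eq_sum)
    also have "\<dots> = (\<Sum>n\<in>Poly_Mapping.keys F. \<Sum>m\<in>Poly_Mapping.keys (Poly_Mapping.lookup F n).
        qscale (Poly_Mapping.lookup (Poly_Mapping.lookup F n) m)
          (Poly_Mapping.single n (Poly_Mapping.single m 1)))"
      by (rule sum.cong[OF refl]) (rule single)
    also have "\<dots> \<in> Rt0.span (mono_seq ` {w. w \<noteq> []})"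
    proof (intro Rt0.span_sum Rt0.span_scale Rt0.span_base)
      fix n m assume "m \<in> Poly_Mapping.keys (Poly_Mapping.lookup F n)"
      then have "Poly_Mapping.keys m \<subseteq> {0..n}" "{1..n} \<subseteq> Poly_Mapping.keys m"
        using Rt0_D[OF F] by simp_all
      then obtain w where "w \<noteq> []" "length w = Suc n" "expo w = m"
        by (rule expo_surj)
      then show "Poly_Mapping.single n (Poly_Mapping.single m 1) \<in> mono_seq ` {w. w \<noteq> []}"
        by (intro image_eqI[of _ _ w]) (simp_all add: mono_seq_def)
    qed
    finally show "F \<in> Rt0.span (mono_seq ` {w. w \<noteq> []})" .
  qed
qed

lemma fam_canon_image: "fam_canon ` Rt0 = fam.span (fam_e ` {w. w \<noteq> []})"
proof -
  have "fam_canon ` Rt0 = fam.span (fam_canon ` mono_seq ` {w. w \<noteq> []})"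
    by (simp only: fam_canon.span_image span_mono_seq)
  also have "fam_canon ` mono_seq ` {w. w \<noteq> []} = fam_e ` {w. w \<noteq> []}"
    unfolding image_image by (rule image_cong) (simp_all add: fam_canon_mono_seq)
  finally show ?thesis .
qed

section \<open>Injectivity of the canonical map\<close>

text \<open>Both sides are linear in \<open>F\<close>, so it suffices to compare them on
  \<open>mono_seq w'\<close>, where \<open>lookup_fam_e\<close> decides. Thus the coefficients of an
  element can be read off its images.\<close>

lemma lookup_canon:
  assumes "F \<in> Rt0" "w \<noteq> []" "length w \<le> Suc k"
  shows "Poly_Mapping.lookup (canon k F) (expo w) =
    Poly_Mapping.lookup (Poly_Mapping.lookup F (length w - 1)) (expo w)"
proof -
  let ?S = "{F. Poly_Mapping.lookup (canon k F) (expo w) =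
    Poly_Mapping.lookup (Poly_Mapping.lookup F (length w - 1)) (expo w)}"
  have "Rt0.subspace ?S"
  proof (rule Rt0.subspaceI)
    have "canon k 0 = 0" by (simp add: canon_def incr_sum_def)
    then show "0 \<in> ?S" by simp
  qed (simp_all add: canon_def incr_sum_add incr_sum_qscale lookup_add lookup_qscale
      lookup_Const_mult)
  moreover have "mono_seq w' \<in> ?S" if "w' \<noteq> []" for w'
  proof -
    have "canon k (mono_seq w') = fam_e w' k"
      using fun_cong[OF fam_canon_mono_seq[OF that], of k] by (simp only: fam_canon_def)
    moreover have "Poly_Mapping.lookup (fam_e w' k) (expo w) = Poly_Mapping.lookup
        (Poly_Mapping.lookup (mono_seq w') (length w - 1)) (expo w)"
    proof (cases "w' = w")
      case True
      then show ?thesis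
        by (simp add: lookup_fam_e[OF assms(2,2,3)] mono_seq_def)
    next
      case False
      have "Poly_Mapping.lookup (Poly_Mapping.lookup (mono_seq w') (length w - 1)) (expo w) = 0"
      proof (cases "length w' = length w")
        case True
        \<comment> \<open>Equality would identify a coefficient 1 with a coefficient 0 of
          \<open>fam_e w'\<close>, both taken at the common length as level.\<close>
        have "expo w' \<noteq> expo w"
        proof
          assume "expo w' = expo w"
          then show False
            using lookup_fam_e'[OF that that] lookup_fam_e'[OF assms(2) that] True False by simp
        qed
        then show ?thesis
          by (simp add: mono_seq_def True lookup_single when_def)
      next
        case False
        then have "length w' - 1 \<noteq> length w - 1"
          using that assms(2) by (cases w; cases w') simp_all
        then show ?thesis
          by (simp add: mono_seq_def lookup_single)
      qed
      then show ?thesis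
        using False by (simp add: lookup_fam_e[OF assms(2) that assms(3)])
    qed
    ultimately show ?thesis by simp
  qed
  ultimately have "Rt0.span (mono_seq ` {w. w \<noteq> []}) \<subseteq> ?S"
    by (intro Rt0.span_minimal) auto
  then show ?thesis using assms(1) span_mono_seq by blast
qed

lemma canon_eqD:
  assumes "F \<in> Rt0" "G \<in> Rt0" "\<And>k. k \<ge> 1 \<Longrightarrow> canon k F = canon k G"
  shows "F = G"
proof (intro poly_mapping_eqI)
  fix n m
  show "Poly_Mapping.lookup (Poly_Mapping.lookup F n) m =
    Poly_Mapping.lookup (Poly_Mapping.lookup G n) m"
  proof (cases "Poly_Mapping.keys m \<subseteq> {0..n} \<and> {1..n} \<subseteq> Poly_Mapping.keys m")
    case True
    then obtain w where "w \<noteq> []" "length w = Suc n" "expo w = m"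
      by (elim conjE expo_surj)
    \<comment> \<open>Level \<open>Suc n\<close> instead of \<open>n\<close> meets the condition
      \<open>k \<ge> 1\<close> also when \<open>n = 0\<close>.\<close>
    then show ?thesis
      using lookup_canon[OF assms(1), of w "Suc n"] lookup_canon[OF assms(2), of w "Suc n"]
        assms(3)[of "Suc n"] by simp
  next
    case False
    then have "m \<notin> Poly_Mapping.keys (Poly_Mapping.lookup F n)"
      "m \<notin> Poly_Mapping.keys (Poly_Mapping.lookup G n)"
      using Rt0_D[OF assms(1), of m n] Rt0_D[OF assms(2), of m n] by argo+
    then show ?thesis by (simp add: in_keys_iff)
  qed
qed

lemma inj_fam_canon: "inj_on fam_canon Rt0"
proof (rule inj_onI)
  fix F G assume "F \<in> Rt0" "G \<in> Rt0" "fam_canon F = fam_canon G"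
  then show "F = G"
    by (intro canon_eqD) (simp_all add: fam_canon_def fun_eq_iff)
qed

section \<open>Products with powers of t_0, and the basis of words\<close>

text \<open>The definite description needs existence and uniqueness. T_b preserves the span of the
  monomial families, which is the image of \<open>Rt0\<close>, so a suitable \<open>H\<close>
  exists; \<open>canon_eqD\<close> makes it unique.\<close>

lemma odot_t0_power:
  assumes "F \<in> Rt0"
  shows "F \<odot> t0_power b \<in> Rt0 \<and> fam_canon (F \<odot> t0_power b) = fam_odot b (fam_canon F)"
proof -
  have "fam_canon F \<in> fam.span (fam_e ` {w. w \<noteq> []})"
    using assms fam_canon_image by blast
  then have "fam_odot b (fam_canon F) \<in> fam.span (fam_e ` {w. w \<noteq> []})"
  proof (rule fam_span_image[OF linear_fam_odot, rotated])
    fix A assume "A \<in> fam_e ` {w. w \<noteq> []}"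
    then obtain w where w: "w \<noteq> []" "A = fam_e w" by blast
    then have "A \<in> fam.span (fam_e ` words (sum_list w + length w))"
      by (auto simp: words_def intro: fam.span_base)
    from fam_odot_span_e[OF this]
    show "fam_odot b A \<in> fam.span (fam_e ` {w. w \<noteq> []})"
      by (rule subsetD[OF fam.span_mono, rotated]) (auto simp: words_def)
  qed
  then obtain H where H: "H \<in> Rt0" "fam_canon H = fam_odot b (fam_canon F)"
    using fam_canon_image by (metis imageE)
  have H_canon: "canon k H = fam_odot b (fam_canon F) k" for k
    using fun_cong[OF H(2), of k] by (simp only: fam_canon_def)
  have odot_eq: "(\<Sum>j=1..k. incr_sum (Var 0) {1..j-1} F * Var j *
      incr_sum (\<Sum>i=0..j. Var i) {j+1..k} (t0_power b)) = fam_odot b (fam_canon F) k" for k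
    by (simp only: fam_odot_def fam_canon_def canon_def incr_sum_t0_power)
  have "F \<odot> t0_power b = H"
    unfolding odot_def odot_eq
  proof (rule the_equality)
    show "H \<in> Rt0 \<and> (\<forall>k\<ge>1. canon k H = fam_odot b (fam_canon F) k)"
      using H(1) H_canon by simp
  next
    fix H' assume H': "H' \<in> Rt0 \<and> (\<forall>k\<ge>1. canon k H' = fam_odot b (fam_canon F) k)"
    show "H' = H"
      by (rule canon_eqD) (use H(1) H' H_canon in simp_all)
  qed
  then show ?thesis using H by (simp only: simp_thms)
qed

text \<open>The reversal reconciles two orders: left-bracketed products grow at the end of the list,
  the lists of \<open>fam_v\<close> at the head.\<close>

lemma odot_word_rev:
  assumes "w \<noteq> []"
  shows "odot_word (rev w) \<in> Rt0 \<and> fam_canon (odot_word (rev w)) = fam_v w"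
  using assms
proof (induction w rule: fam_v.induct)
  case (2 a)
  have "odot_word [a] = mono_seq [a]"
    by (simp add: odot_word_def t0_power_def mono_seq_def Var_power)
  then show ?case
    by (simp add: mono_seq_in_Rt0 fam_canon_mono_seq)
next
  case (3 b c w)
  have "odot_word (rev (b # c # w)) = odot_word (rev (c # w)) \<odot> t0_power b"
    by (cases "rev w") (simp_all add: odot_word_def)
  then show ?case
    using 3 odot_t0_power by simp
qed simp

theorem theorem8p6:
  shows "inj_on odot_word {as. as \<noteq> []} \<and>
    Rt0.independent (odot_word ` {as. as \<noteq> []}) \<and>
    Rt0.span (odot_word ` {as. as \<noteq> []}) = Rt0"
proof -
  let ?O = "odot_word ` {as. as \<noteq> []}"
  have canon: "odot_word as \<in> Rt0" "fam_canon (odot_word as) = fam_v (rev as)" if "as \<noteq> []" for as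
    using odot_word_rev[of "rev as"] that by auto
  have inj: "inj_on (fam_canon \<circ> odot_word) {as. as \<noteq> []}"
  proof (rule inj_onI)
    fix as as' :: "nat list"
    assume "as \<in> {as. as \<noteq> []}" "as' \<in> {as. as \<noteq> []}"
      "(fam_canon \<circ> odot_word) as = (fam_canon \<circ> odot_word) as'"
    then show "as = as'"
      using inj_onD[OF inj_fam_v, of "rev as" "rev as'"] by (simp add: canon)
  qed
  have image: "fam_canon ` ?O = fam_v ` {w. w \<noteq> []}"
  proof -
    have "fam_canon ` ?O = fam_v ` rev ` {w. w \<noteq> []}"
      unfolding image_image by (rule image_cong) (simp_all add: canon)
    also have "rev ` {w. w \<noteq> []} = {w :: nat list. w \<noteq> []}"
      by (auto intro: image_eqI[of _ rev "rev w" for w])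
    finally show ?thesis .
  qed
  have sub: "Rt0.span ?O \<subseteq> Rt0"
    using canon by (intro Rt0.span_minimal subspace_Rt0) auto
  have "Rt0.independent ?O"
  proof
    assume "Rt0.dependent ?O"
    then obtain a where a: "a \<in> ?O" "a \<in> Rt0.span (?O - {a})"
      unfolding Rt0.dependent_def by blast
    \<comment> \<open>Injectivity lets the removal of \<open>a\<close> commute with taking images,
      so a dependence among products passes to their families.\<close>
    have "inj_on fam_canon ?O"
      using canon by (intro inj_on_subset[OF inj_fam_canon]) auto
    then have "fam_canon ` (?O - {a}) = fam_canon ` ?O - {fam_canon a}"
      using a(1) by (auto dest: inj_onD)
    moreover have "fam_canon a \<in> fam.span (fam_canon ` (?O - {a}))"
      using a(2) unfolding fam_canon.span_image by blast
    ultimately have "fam.dependent (fam_canon ` ?O)"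
      unfolding fam.dependent_def using a(1) by auto
    then show False
      using independent_fam_v image by simp
  qed
  \<comment> \<open>Each image of an element of \<open>Rt0\<close> is also the image of a
    combination of products. By \<open>sub\<close> that combination lies in \<open>Rt0\<close>,
    where \<open>fam_canon\<close> is injective, so it is the element itself.\<close>
  moreover have "Rt0 \<subseteq> Rt0.span ?O"
  proof -
    have "fam_e w \<in> fam.span (fam_v ` {w. w \<noteq> []})" if "w \<noteq> []" for w
    proof -
      have "fam_e w \<in> fam.span (fam_v ` words (sum_list w + length w))"
        using that by (intro subsetD[OF fam_e_span_v]) (simp add: words_def)
      then show ?thesis
        by (rule subsetD[OF fam.span_mono, rotated]) (auto simp: words_def)
    qed
    then have "fam_canon ` Rt0 \<subseteq> fam.span (fam_v ` {w. w \<noteq> []})"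
      unfolding fam_canon_image by (intro fam.span_minimal) auto
    also have "\<dots> = fam_canon ` Rt0.span ?O"
      by (simp only: fam_canon.span_image flip: image)
    finally have image_sub: "fam_canon ` Rt0 \<subseteq> fam_canon ` Rt0.span ?O" .
    show ?thesis
    proof
      fix F assume F: "F \<in> Rt0"
      then obtain G where G: "G \<in> Rt0.span ?O" "fam_canon F = fam_canon G"
        using image_sub by blast
      have "F = G"
        by (rule inj_onD[OF inj_fam_canon G(2) F subsetD[OF sub G(1)]])
      then show "F \<in> Rt0.span ?O" using G(1) by simp
    qed
  qed
  ultimately show ?thesis
    using sub inj inj_on_imageI2 by blast
qed

end
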